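(* Suppose Alice is given a matroid $\mathcal{M}_1=(U,\mathcal{I}_1)$ and Bob is given a matroid $\mathcal{M}_2=(U,\mathcal{I}_2)$ on a common ground set $U$ with $|U|=n$. Any deterministic communication protocol between Alice and Bob that solves the matroid intersection problem (finding a maximum-size set in $\mathcal{I}_1\cap\mathcal{I}_2$) requires $\Omega(n\log n)$ bits of communication. *)

theory Defs
  imports Complex_Main
begin

locale matroid =
  fixes U :: "'a set" and indep :: "'a set set"
  assumes finite_ground: "finite U"
    and indep_subset: "indep \<subseteq> Pow U"
    and empty_indep: "{} \<in> indep"
    and hereditary: "\<lbrakk>Y \<in> indep; X \<subseteq> Y\<rbrakk> \<Longrightarrow> X \<in> indep"
    and augmentation:
      "\<lbrakk>X \<in> indep; Y \<in> indep; card X < card Y\<rbrakk> \<Longrightarrow> \<exists>e \<in> Y - X. insert e X \<in> indep"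

text \<open>
  Deterministic two-party protocols as binary trees, following Yao: at each inner node the
  player who owns it sends one bit, an arbitrary function of that player's own input (and, via the
  position of the node in the tree, of the bits exchanged so far).  A leaf carries the output, which
  is hence determined by the transcript and known to both players.
\<close>

datatype ('x, 'y, 'z) protocol =
    Output 'z
  | Alice "'x \<Rightarrow> bool" "('x, 'y, 'z) protocol" "('x, 'y, 'z) protocol"
  | Bob "'y \<Rightarrow> bool" "('x, 'y, 'z) protocol" "('x, 'y, 'z) protocol"

primrec outcome :: "('x, 'y, 'z) protocol \<Rightarrow> 'x \<Rightarrow> 'y \<Rightarrow> 'z" where
  "outcome (Output z) x y = z"
| "outcome (Alice f P Q) x y = (if f x then outcome P x y else outcome Q x y)"
| "outcome (Bob g P Q) x y = (if g y then outcome P x y else outcome Q x y)"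

primrec bits :: "('x, 'y, 'z) protocol \<Rightarrow> 'x \<Rightarrow> 'y \<Rightarrow> nat" where
  "bits (Output z) x y = 0"
| "bits (Alice f P Q) x y = Suc (if f x then bits P x y else bits Q x y)"
| "bits (Bob g P Q) x y = Suc (if g y then bits P x y else bits Q x y)"

text \<open>
  The ground set is known to both players, so the input of a player is just the family of
  independent sets of that player's matroid.
\<close>

type_synonym 'a matroid_protocol = "('a set set, 'a set set, 'a set) protocol"

definition solves_matroid_intersection :: "'a set \<Rightarrow> 'a matroid_protocol \<Rightarrow> bool" where
  "solves_matroid_intersection U P \<longleftrightarrow>
     (\<forall>I1 I2. matroid U I1 \<and> matroid U I2 \<longrightarrow>
        is_arg_max card (\<lambda>S. S \<in> I1 \<inter> I2) (outcome P I1 I2))"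

text \<open>
  Worst case over pairs of matroids on \<open>U\<close> only.  For finite \<open>U\<close> the maximum
  ranges over a finite nonempty set; it is at most the height of the protocol tree.
\<close>

definition communication_cost :: "'a set \<Rightarrow> 'a matroid_protocol \<Rightarrow> nat" where
  "communication_cost U P = Max {bits P I1 I2 | I1 I2. matroid U I1 \<and> matroid U I2}"

end

theory Submission
  imports Defs "HOL-Library.Disjoint_Sets" "HOL-Library.FuncSet"
begin

text \<open>
  Let Alice and Bob hold partitions \<open>P\<close> and \<open>Q\<close> of a set \<open>V\<close> with two marked points
  \<open>s\<close> and \<open>t\<close>.  On two copies of \<open>V\<close> they form partition matroids whose capacities are the
  block sizes, except that Bob moves one unit of capacity from the block of \<open>s\<close> to that of
  \<open>t\<close>.  A common independent set of size \<open>card V\<close> exists iff the join of \<open>P\<close> and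
  \<open>Q\<close> connects \<open>s\<close> with \<open>t\<close>, so the protocol decides this.  Hence the 0/1 matrix of
  disconnection has rank at most \<open>2\<^sup>d\<close>, where \<open>d\<close> is the communication cost.

  On partitions separating \<open>s\<close> from \<open>t\<close> this matrix is nonsingular: Moebius inversion factors
  it as \<open>\<zeta> D \<zeta>\<^sup>T\<close>, where \<open>\<zeta>\<close> is the refinement order and the diagonal entries
  \<open>(-1)\<^sup>b (b - 2)!\<close> of \<open>D\<close> do not vanish.  There are at least \<open>k\<^sup>k\<close> such partitions
  with \<open>k\<close> about \<open>n/4\<close>, so \<open>d \<ge> k log k\<close>.
\<close>

subsection \<open>Weighted sums over partitions\<close>

definition separates :: "'a \<Rightarrow> 'a \<Rightarrow> 'a set set \<Rightarrow> bool" where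
  "separates s t Z \<longleftrightarrow> (\<forall>B\<in>Z. s \<in> B \<longrightarrow> t \<notin> B)"

text \<open>The choice \<open>B = {}\<close> makes \<open>{v}\<close> a new block.\<close>

definition add_point :: "'a \<Rightarrow> 'a set set \<times> 'a set \<Rightarrow> 'a set set" where
  "add_point v = (\<lambda>(Z, B). insert (insert v B) (Z - {B}))"

lemma partition_on_disjoint:
  "partition_on A Z \<Longrightarrow> B \<in> Z \<Longrightarrow> C \<in> Z \<Longrightarrow> x \<in> B \<Longrightarrow> x \<in> C \<Longrightarrow> B = C"
  unfolding partition_on_def disjoint_def by blast

text \<open>The inverse deletes \<open>v\<close> from its block and remembers what is left of it. If
  the block was \<open>{v}\<close>, the rest is \<open>{}\<close>, which is dropped from the family
  and kept as the marker for a new block.\<close>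

lemma bij_betw_add_point:
  assumes "v \<notin> A"
  shows "bij_betw (add_point v) (SIGMA Z:{Z. partition_on A Z}. insert {} Z)
           {Z. partition_on (insert v A) Z}"
proof (rule bij_betw_byWitness[where f' = "\<lambda>Z. (((\<lambda>B. B - {v}) ` Z) - {{}}, \<Union>{B \<in> Z. v \<in> B} - {v})"])
  have nv: "v \<notin> C" if "partition_on A Z" "C \<in> Z" for Z C
    using assms that partition_onD1 by fastforce
  show "\<forall>x\<in>SIGMA Z:{Z. partition_on A Z}. insert {} Z.
      (((\<lambda>B. B - {v}) ` add_point v x) - {{}}, \<Union>{B \<in> add_point v x. v \<in> B} - {v}) = x"
  proof (intro ballI)
    fix x assume "x \<in> (SIGMA Z:{Z. partition_on A Z}. insert {} Z)"
    then obtain Z B where x: "x = (Z, B)" and Z: "partition_on A Z" and B: "B = {} \<or> B \<in> Z"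
      by auto
    have vB: "v \<notin> B" using B nv[OF Z] by auto
    have "{C \<in> add_point v (Z, B). v \<in> C} = {insert v B}"
      using nv[OF Z] by (auto simp: add_point_def)
    moreover have "(\<lambda>B. B - {v}) ` (Z - {B}) = Z - {B}"
      using nv[OF Z] by (intro image_cong[OF refl, of _ _ "\<lambda>B. B", simplified]) auto
    then have "(\<lambda>B. B - {v}) ` add_point v (Z, B) - {{}} = Z"
      using vB B partition_onD3[OF Z] by (auto simp: add_point_def)
    ultimately show "(((\<lambda>B. B - {v}) ` add_point v x) - {{}},
        \<Union>{C \<in> add_point v x. v \<in> C} - {v}) = x"
      using vB by (simp add: x)
  qed
  \<comment> \<open>Exactly one block contains \<open>v\<close>, so deleting \<open>v\<close>
    everywhere alters only that block.\<close>
  have block: "\<exists>D. D \<in> Z \<and> v \<in> D \<and> {B \<in> Z. v \<in> B} = {D} \<and> (\<lambda>B. B - {v}) ` Z = insert (D - {v}) (Z - {D})"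
    if Z: "partition_on (insert v A) Z" for Z
  proof -
    obtain D where D: "D \<in> Z" "v \<in> D" using partition_onD1[OF Z] by blast
    have un: "C = D" if "C \<in> Z" "v \<in> C" for C
      using partition_on_disjoint[OF Z] that D by blast
    have "(\<lambda>B. B - {v}) ` (Z - {D}) = Z - {D}"
      using un by (intro image_cong[OF refl, of _ _ "\<lambda>B. B", simplified]) auto
    moreover have "(\<lambda>B. B - {v}) ` Z = insert (D - {v}) ((\<lambda>B. B - {v}) ` (Z - {D}))"
      using D by blast
    moreover have "{B \<in> Z. v \<in> B} = {D}" using D un by blast
    ultimately show ?thesis using D by metis
  qed
  show "\<forall>Z\<in>{Z. partition_on (insert v A) Z}.
      add_point v (((\<lambda>B. B - {v}) ` Z) - {{}}, \<Union>{B \<in> Z. v \<in> B} - {v}) = Z"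
  proof (intro ballI)
    fix Z assume "Z \<in> {Z. partition_on (insert v A) Z}"
    then have Z: "partition_on (insert v A) Z" by simp
    obtain D where D: "D \<in> Z" "v \<in> D" "{B \<in> Z. v \<in> B} = {D}"
      "(\<lambda>B. B - {v}) ` Z = insert (D - {v}) (Z - {D})" using block[OF Z] by metis
    \<comment> \<open>\<open>add_point\<close> removes \<open>D - {v}\<close> from the family; were
      it also a block of \<open>Z\<close>, that block would be lost.\<close>
    have "D - {v} \<notin> Z"
    proof
      assume "D - {v} \<in> Z"
      then have "D - {v} \<noteq> {}" using partition_onD3[OF Z] by metis
      then obtain x where "x \<in> D - {v}" by blast
      then show False using partition_on_disjoint[OF Z \<open>D - {v} \<in> Z\<close> D(1), of x] D(2) by auto
    qed
    moreover have "insert v (D - {v}) = D" using D by auto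
    moreover have "{} \<notin> Z" using partition_onD3[OF Z] .
    ultimately show "add_point v (((\<lambda>B. B - {v}) ` Z) - {{}}, \<Union>{B \<in> Z. v \<in> B} - {v}) = Z"
      unfolding D(3,4) using D(1) by (auto simp: add_point_def)
  qed
  show "add_point v ` (SIGMA Z:{Z. partition_on A Z}. insert {} Z) \<subseteq> {Z. partition_on (insert v A) Z}"
  proof (intro image_subsetI)
    fix x assume "x \<in> (SIGMA Z:{Z. partition_on A Z}. insert {} Z)"
    then obtain Z B where x: "x = (Z, B)" and Z: "partition_on A Z" and B: "B = {} \<or> B \<in> Z"
      by auto
    have "disjnt (insert v B) (\<Union>(Z - {B}))"
      using nv[OF Z] B partition_on_disjoint[OF Z] by (auto simp: disjnt_iff)
    moreover have "partition_on (insert v A - insert v B) (Z - {B})"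
    proof (cases "B = {}")
      case True
      then show ?thesis using Z assms partition_onD3[OF Z] by simp
    next
      case False
      then have "B \<in> Z" using B by auto
      have "disjnt B (\<Union>(Z - {B}))"
        using \<open>B \<in> Z\<close> partition_on_disjoint[OF Z] by (auto simp: disjnt_iff)
      then have "partition_on (A - B) (Z - {B})"
        using partition_on_insert[of B "Z - {B}" A] Z \<open>B \<in> Z\<close> by (simp add: insert_absorb)
      moreover have "insert v A - insert v B = A - B" using assms by auto
      ultimately show ?thesis by simp
    qed
    moreover have "insert v B \<subseteq> insert v A" using B partition_onD1[OF Z] by auto
    ultimately show "add_point v x \<in> {Z. partition_on (insert v A) Z}"
      by (simp add: x add_point_def partition_on_insert)
  qed
  show "(\<lambda>Z. (((\<lambda>B. B - {v}) ` Z) - {{}}, \<Union>{B \<in> Z. v \<in> B} - {v})) ` {Z. partition_on (insert v A) Z}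
      \<subseteq> (SIGMA Z:{Z. partition_on A Z}. insert {} Z)"
  proof (intro image_subsetI)
    fix Z assume "Z \<in> {Z. partition_on (insert v A) Z}"
    then have Z: "partition_on (insert v A) Z" by simp
    obtain D where D: "D \<in> Z" "v \<in> D" "{B \<in> Z. v \<in> B} = {D}"
      "(\<lambda>B. B - {v}) ` Z = insert (D - {v}) (Z - {D})" using block[OF Z] by metis
    have "partition_on (A \<inter> insert v A) ((\<inter>) A ` Z - {{}})"
      using partition_on_restrict[OF Z] .
    moreover have "(\<inter>) A ` Z = (\<lambda>B. B - {v}) ` Z"
    proof (rule image_cong[OF refl])
      fix B assume "B \<in> Z"
      then have "B \<subseteq> insert v A" using partition_onD1[OF Z] by auto
      then show "A \<inter> B = B - {v}" using assms by auto
    qed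
    moreover have "A \<inter> insert v A = A" by auto
    ultimately show "(((\<lambda>B. B - {v}) ` Z) - {{}}, \<Union>{B \<in> Z. v \<in> B} - {v})
      \<in> (SIGMA Z:{Z. partition_on A Z}. insert {} Z)"
      using D by auto
  qed
qed

text \<open>
  This is the falling factorial \<open>(-1)(-2)\<dots>(-(b-2))\<close> for \<open>b = card Z\<close>: colour the blocks of a
  partition of \<open>A\<close> with \<open>q\<close> colours besides two reserved for \<open>s\<close> and \<open>t\<close>, group the
  colourings by their kernel \<open>Z\<close>, and put \<open>q = -1\<close>.
\<close>

definition cut_weight :: "'a set set \<Rightarrow> real" where
  "cut_weight Z = (- 1) ^ card Z * fact (card Z - 2)"

lemma cut_weight_nonzero: "cut_weight Z \<noteq> 0"
  by (simp add: cut_weight_def)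

text \<open>For an equivalence \<open>R\<close>, the blocks are unions of \<open>R\<close>-classes.
  Intersecting with \<open>A\<close> lets \<open>R\<close> stay fixed while \<open>A\<close> grows
  point by point.\<close>

definition saturated :: "('a \<times> 'a) set \<Rightarrow> 'a set \<Rightarrow> 'a set set \<Rightarrow> bool" where
  "saturated R A Z \<longleftrightarrow> (\<forall>B\<in>Z. R `` B \<inter> A \<subseteq> B)"

lemma card_add_point:
  assumes "finite A" "v \<notin> A" "partition_on A Z" "B \<in> insert {} Z"
  shows "card (add_point v (Z, B)) = (if B = {} then Suc (card Z) else card Z)"
proof -
  have fin: "finite Z" using finite_elements[OF assms(1,3)] .
  have "v \<notin> C" if "C \<in> Z" for C using assms that partition_onD1 by fastforce
  then have "insert v B \<notin> Z - {B}" by blast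
  then have "card (add_point v (Z, B)) = Suc (card (Z - {B}))"
    using fin by (simp add: add_point_def)
  moreover have "{} \<notin> Z" using partition_onD3[OF assms(3)] .
  ultimately show ?thesis using assms(4) fin
    by (auto simp del: card_Diff_insert simp: card_Suc_Diff1)
qed

lemma separates_card_ge_2:
  assumes "finite A" "partition_on A Z" "separates s t Z" "s \<in> A" "t \<in> A"
  shows "2 \<le> card Z"
proof -
  obtain B C where "B \<in> Z" "C \<in> Z" "s \<in> B" "t \<in> C"
    using assms(4,5) partition_onD1[OF assms(2)] by blast
  moreover from this have "B \<noteq> C" using assms(3) by (auto simp: separates_def)
  ultimately have "card {B, C} \<le> card Z"
    using finite_elements[OF assms(1,2)] by (intro card_mono) auto
  then show ?thesis using \<open>B \<noteq> C\<close> by simp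
qed

text \<open>Extending a partition with \<open>b\<close> blocks by \<open>v\<close> preserves its
  total weight. If \<open>v\<close> is related to no point of \<open>A\<close>, it may enter any of
  the \<open>b\<close> blocks or form a new one, and the weight \<open>w\<close> satisfies
  \<open>b * w(b) + w(b + 1) = w(b)\<close> because \<open>w(b + 1) = - (b - 1) * w(b)\<close>.
  Otherwise its relatives lie in a single block, which \<open>v\<close> must join, and the block
  count stays the same.\<close>

lemma sum_add_point:
  assumes fin: "finite A" and v: "v \<notin> A" and st: "s \<in> A" "t \<in> A"
    and R: "sym R" "trans R" and Z: "partition_on A Z"
  shows "(\<Sum>B\<in>insert {} Z. if separates s t (add_point v (Z, B)) \<and> saturated R (insert v A) (add_point v (Z, B))
            then cut_weight (add_point v (Z, B)) else 0)
       = (if separates s t Z \<and> saturated R A Z then cut_weight Z else 0)"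
proof -
  have nv: "v \<notin> C" if "C \<in> Z" for C
    using v that partition_onD1[OF Z] by auto
  have subA: "C \<subseteq> A" if "C \<in> Z" for C
    using that partition_onD1[OF Z] by auto
  have finZ: "finite Z" using finite_elements[OF fin Z] .
  have ne: "{} \<notin> Z" using partition_onD3[OF Z] .
  have vst: "v \<noteq> s" "v \<noteq> t" using v st by auto
  have sep: "separates s t (add_point v (Z, B)) \<longleftrightarrow> separates s t Z" if "B \<in> insert {} Z" for B
    using that vst by (auto simp: separates_def add_point_def)
  \<comment> \<open>Saturation of the extension splits into saturation of \<open>Z\<close> and the
    one new demand that the block receiving \<open>v\<close> contain all relatives of
    \<open>v\<close> in \<open>A\<close>.\<close>
  have resp: "saturated R (insert v A) (add_point v (Z, B)) \<longleftrightarrow> saturated R A Z \<and> R `` {v} \<inter> A \<subseteq> B"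
    (is "?l \<longleftrightarrow> ?r") if B: "B \<in> insert {} Z" for B
  proof
    assume l: ?l
    then have *: "R `` (insert v B) \<inter> insert v A \<subseteq> insert v B"
      by (auto simp: saturated_def add_point_def)
    moreover have "R `` C \<inter> A \<subseteq> C" if "C \<in> Z" for C
    proof (cases "C = B")
      case True
      then show ?thesis using * v by auto
    next
      case False
      then have "C \<in> add_point v (Z, B)" using that by (auto simp: add_point_def)
      then show ?thesis using l unfolding saturated_def by blast
    qed
    ultimately show ?r using v by (auto simp: saturated_def)
  next
    assume r: ?r
    have "R `` C \<inter> insert v A \<subseteq> C" if C: "C \<in> Z" "C \<noteq> B" for C
    proof
      fix y assume y: "y \<in> R `` C \<inter> insert v A"
      then obtain x where x: "x \<in> C" "(x, y) \<in> R" by auto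
      have "y \<noteq> v"
      proof
        assume "y = v"
        then have "x \<in> B" using x R(1) r subA[OF C(1)] by (auto dest: symD)
        then have "B \<in> Z" using B by auto
        then show False using partition_on_disjoint[OF Z C(1)] x \<open>x \<in> B\<close> C(2) by blast
      qed
      then show "y \<in> C" using r C x y unfolding saturated_def by blast
    qed
    moreover have "R `` (insert v B) \<inter> insert v A \<subseteq> insert v B"
      using r B by (auto simp: saturated_def)
    ultimately show ?l by (auto simp: saturated_def add_point_def)
  qed
  have cw: "cut_weight (add_point v (Z, B)) = (if B = {} then (- 1) ^ Suc (card Z) * fact (card Z - 1) else cut_weight Z)"
    if "B \<in> insert {} Z" for B
    using card_add_point[OF fin v Z that] by (auto simp: cut_weight_def)
  show ?thesis
  proof (cases "separates s t Z \<and> saturated R A Z")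
    case False
    then show ?thesis by (auto simp: sep resp intro!: sum.neutral)
  next
    case True
    have "(\<Sum>B\<in>insert {} Z. if R `` {v} \<inter> A \<subseteq> B then cut_weight (add_point v (Z, B)) else 0) = cut_weight Z"
    proof (cases "R `` {v} \<inter> A = {}")
      case True': True
      have "2 \<le> card Z" using separates_card_ge_2[OF fin Z _ st] True by simp
      \<comment> \<open>With at least two blocks, the truncated subtraction inside the factorial is
        exact, as the recurrence of the weights requires.\<close>
      then obtain k where k: "card Z = Suc (Suc k)" by (metis add_2_eq_Suc le_Suc_ex)
      have "(\<Sum>B\<in>insert {} Z. if R `` {v} \<inter> A \<subseteq> B then cut_weight (add_point v (Z, B)) else 0)
          = (- 1) ^ Suc (card Z) * fact (card Z - 1) + (\<Sum>B\<in>Z. cut_weight (add_point v (Z, B)))"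
        using finZ ne cw[of "{}"] True' by simp
      also have "(\<Sum>B\<in>Z. cut_weight (add_point v (Z, B))) = (\<Sum>B\<in>Z. cut_weight Z)"
        using ne cw by (intro sum.cong) auto
      also have "(- 1) ^ Suc (card Z) * fact (card Z - 1) + (\<Sum>B\<in>Z. cut_weight Z) = cut_weight Z"
        by (simp add: cut_weight_def k algebra_simps)
      finally show ?thesis .
    next
      case False
      then obtain u where u: "(v, u) \<in> R" "u \<in> A" by auto
      then obtain D where D: "D \<in> Z" "u \<in> D" using partition_onD1[OF Z] by auto
      \<comment> \<open>Every relative of \<open>v\<close> is a relative of \<open>u\<close>, and
        the block \<open>D\<close> of \<open>u\<close> is saturated.\<close>
      have "R `` {v} \<inter> A \<subseteq> D"
      proof
        fix y assume "y \<in> R `` {v} \<inter> A"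
        moreover from this have "(u, y) \<in> R" using u R by (auto dest: symD transD)
        ultimately show "y \<in> D" using True D unfolding saturated_def by blast
      qed
      moreover have "\<not> R `` {v} \<inter> A \<subseteq> B" if "B \<in> insert {} Z" "B \<noteq> D" for B
        using that D u partition_on_disjoint[OF Z, of B D u] by auto
      ultimately have "(if R `` {v} \<inter> A \<subseteq> B then cut_weight (add_point v (Z, B)) else 0)
          = (if B = D then cut_weight Z else 0)" if "B \<in> insert {} Z" for B
        using that cw[of B] D(2) by auto
      then have "(\<Sum>B\<in>insert {} Z. if R `` {v} \<inter> A \<subseteq> B then cut_weight (add_point v (Z, B)) else 0)
          = (\<Sum>B\<in>insert {} Z. if B = D then cut_weight Z else 0)"
        by (intro sum.cong) auto
      then show ?thesis using finZ D by (simp add: sum.delta)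
    qed
    moreover have "(\<Sum>B\<in>insert {} Z. if separates s t (add_point v (Z, B)) \<and> saturated R (insert v A) (add_point v (Z, B))
            then cut_weight (add_point v (Z, B)) else 0) =
       (\<Sum>B\<in>insert {} Z. if R `` {v} \<inter> A \<subseteq> B then cut_weight (add_point v (Z, B)) else 0)"
      using True by (intro sum.cong refl if_cong) (simp_all only: sep resp, auto)
    ultimately show ?thesis using True by simp
  qed
qed

text \<open>Induction on the points other than \<open>s\<close> and \<open>t\<close>. On
  \<open>{s, t}\<close> the only separating partition is \<open>{{s}, {t}}\<close>, of weight 1, and
  each further point leaves the sum unchanged by \<open>sum_add_point\<close>.\<close>

lemma sum_cut_weight:
  assumes "finite A" "s \<in> A" "t \<in> A" "s \<noteq> t" and R: "sym R" "trans R" "(s, t) \<notin> R"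
  shows "(\<Sum>Z | partition_on A Z \<and> separates s t Z \<and> saturated R A Z. cut_weight Z) = 1"
proof -
  have sum_if: "(\<Sum>Z | partition_on A Z \<and> separates s t Z \<and> saturated R A Z. cut_weight Z)
      = (\<Sum>Z | partition_on A Z. if separates s t Z \<and> saturated R A Z then cut_weight Z else 0)"
    if "finite A" for A :: "'a set"
    using finitely_many_partition_on[OF that]
    by (subst sum.inter_filter[symmetric]) (auto intro!: sum.cong)
  have "(\<Sum>Z | partition_on (insert s (insert t F)) Z \<and> separates s t Z \<and> saturated R (insert s (insert t F)) Z. cut_weight Z) = 1"
    if "finite F" for F
    using that
  proof (induction F rule: finite_induct)
    case empty
    have "{Z. partition_on {s, t} Z \<and> separates s t Z \<and> saturated R {s, t} Z} = {{{s}, {t}}}"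
    proof (intro equalityI subsetI)
      fix Z assume "Z \<in> {Z. partition_on {s, t} Z \<and> separates s t Z \<and> saturated R {s, t} Z}"
      then have Z: "partition_on {s, t} Z" "separates s t Z" by auto
      have el: "B = {s} \<or> B = {t}" if "B \<in> Z" for B
      proof -
        have "B \<subseteq> {s, t}" using that partition_onD1[OF Z(1)] by auto
        moreover have "B \<noteq> {}" "B \<noteq> {s, t}"
          using that Z(2) partition_onD3[OF Z(1)] by (auto simp: separates_def)
        ultimately show ?thesis by blast
      qed
      obtain B C where "B \<in> Z" "s \<in> B" "C \<in> Z" "t \<in> C" using partition_onD1[OF Z(1)] by blast
      then have "{s} \<in> Z" "{t} \<in> Z" using el[of B] el[of C] assms(4) by (metis singletonD)+
      then show "Z \<in> {{{s}, {t}}}" using el by auto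
    next
      fix Z assume "Z \<in> {{{s}, {t}}}"
      moreover have "(t, s) \<notin> R" using R by (auto dest: symD)
      ultimately show "Z \<in> {Z. partition_on {s, t} Z \<and> separates s t Z \<and> saturated R {s, t} Z}"
        using R(3) assms(4) by (auto simp: partition_on_def disjoint_def separates_def saturated_def)
    qed
    then show ?case using assms(4) by (simp add: cut_weight_def)
  next
    case (insert v F)
    show ?case
    proof (cases "v = s \<or> v = t")
      case True
      then have "insert s (insert t (insert v F)) = insert s (insert t F)" by auto
      then show ?thesis using insert.IH by simp
    next
      case False
      define A where "A = insert s (insert t F)"
      have A: "finite A" "v \<notin> A" "s \<in> A" "t \<in> A" using insert.hyps False by (auto simp: A_def)
      \<comment> \<open>Extending the weight by zero to all partitions makes the sum over
        \<open>insert v A\<close> reindexable along \<open>add_point\<close>.\<close>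
      define w where "w = (\<lambda>A Z. if separates s t Z \<and> saturated R A Z then cut_weight Z else 0)"
      have "(\<Sum>Z | partition_on (insert v A) Z. w (insert v A) Z)
          = (\<Sum>p\<in>(SIGMA Z:{Z. partition_on A Z}. insert {} Z). w (insert v A) (add_point v p))"
        by (rule sum.reindex_bij_betw[OF bij_betw_add_point[OF A(2)], symmetric])
      also have "\<dots> = (\<Sum>Z | partition_on A Z. \<Sum>B\<in>insert {} Z. w (insert v A) (add_point v (Z, B)))"
        using finitely_many_partition_on[OF A(1)] finite_elements[OF A(1)]
        by (subst sum.Sigma) (auto intro!: sum.cong)
      also have "\<dots> = (\<Sum>Z | partition_on A Z. w A Z)"
        unfolding w_def by (rule sum.cong[OF refl], rule sum_add_point[OF A R(1,2)]) auto
      also have "\<dots> = 1"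
        using insert.IH sum_if[OF A(1)] by (simp add: w_def A_def)
      finally show ?thesis
        using sum_if[of "insert v A"] A(1) by (simp add: w_def A_def insert_commute)
    qed
  qed
  from this[of A] show ?thesis using assms(1-3) by (simp add: insert_absorb)
qed

subsection \<open>Connectivity in the join of two partitions\<close>

definition block_rel :: "'a set set \<Rightarrow> ('a \<times> 'a) set" where
  "block_rel P = {(x, y). \<exists>B\<in>P. x \<in> B \<and> y \<in> B}"

text \<open>This is the equivalence of the join in the partition lattice. Reflexivity on the ground
  set comes from the blocks, and the irreflexive closure operator adds no pairs outside it.\<close>

definition join_rel :: "'a set set \<Rightarrow> 'a set set \<Rightarrow> ('a \<times> 'a) set" where
  "join_rel P Q = (block_rel P \<union> block_rel Q)\<^sup>+"

lemma sym_join_rel: "sym (join_rel P Q)"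
  unfolding join_rel_def by (intro sym_trancl) (auto simp: sym_def block_rel_def)

lemma trans_join_rel: "trans (join_rel P Q)"
  by (simp add: join_rel_def)

lemma refines_iff_block_rel_closed:
  assumes "partition_on A P" "partition_on A Z"
  shows "refines A P Z \<longleftrightarrow> (\<forall>D\<in>Z. block_rel P `` D \<subseteq> D)"
proof
  assume "refines A P Z"
  then show "\<forall>D\<in>Z. block_rel P `` D \<subseteq> D"
    using partition_on_disjoint[OF assms(2)] unfolding refines_def block_rel_def
    by fast
next
  assume r: "\<forall>D\<in>Z. block_rel P `` D \<subseteq> D"
  have "\<exists>D\<in>Z. B \<subseteq> D" if B: "B \<in> P" for B
  proof -
    obtain x where "x \<in> B" using B partition_onD3[OF assms(1)] by (metis ex_in_conv)
    moreover from this B obtain D where D: "D \<in> Z" "x \<in> D"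
      using partition_onD1[OF assms(1)] partition_onD1[OF assms(2)] by blast
    ultimately have "B \<subseteq> block_rel P `` D" using B by (auto simp: block_rel_def)
    then show ?thesis using r D by blast
  qed
  then show "refines A P Z" using assms by (simp add: refines_def)
qed

text \<open>The universal property of the join: a set closed under the two generating relations is
  closed under their transitive closure.\<close>

lemma saturated_join_rel_iff:
  assumes "partition_on A P" "partition_on A Q" "partition_on A Z"
  shows "saturated (join_rel P Q) A Z \<longleftrightarrow> refines A P Z \<and> refines A Q Z"
proof
  assume s: "saturated (join_rel P Q) A Z"
  have "block_rel P `` D \<subseteq> D \<and> block_rel Q `` D \<subseteq> D" if "D \<in> Z" for D
  proof -
    have "block_rel P \<union> block_rel Q \<subseteq> join_rel P Q" unfolding join_rel_def by auto
    moreover have "block_rel P `` D \<subseteq> A" "block_rel Q `` D \<subseteq> A"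
      using partition_onD1[OF assms(1)] partition_onD1[OF assms(2)] by (auto simp: block_rel_def)
    ultimately show ?thesis using s that unfolding saturated_def by blast
  qed
  then show "refines A P Z \<and> refines A Q Z"
    using refines_iff_block_rel_closed assms by blast
next
  assume "refines A P Z \<and> refines A Q Z"
  then have c: "\<forall>D\<in>Z. (block_rel P \<union> block_rel Q) `` D \<subseteq> D"
    using refines_iff_block_rel_closed assms by blast
  have "y \<in> D" if "(x, y) \<in> join_rel P Q" "x \<in> D" "D \<in> Z" for x y D
    using that(1) unfolding join_rel_def
    by (induction rule: trancl_induct) (use that c in blast)+
  then show "saturated (join_rel P Q) A Z" unfolding saturated_def by blast
qed

text \<open>The factorisation of the disconnection matrix. The product of the two refinement
  indicators is the indicator of saturation under the join. If the join connects \<open>s\<close>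
  and \<open>t\<close>, no saturated partition separates them and the sum is empty; otherwise
  \<open>sum_cut_weight\<close> gives 1.\<close>

lemma disconnected_eq_sum_cut_weight:
  assumes "finite A" "s \<in> A" "t \<in> A" "s \<noteq> t" and P: "partition_on A P" and Q: "partition_on A Q"
  shows "(if (s, t) \<in> join_rel P Q then 0 else 1) =
    (\<Sum>Z | partition_on A Z \<and> separates s t Z.
       (if refines A P Z then 1 else 0) * ((if refines A Q Z then 1 else 0) * cut_weight Z))"
proof -
  let ?S = "{Z. partition_on A Z \<and> separates s t Z}"
  have "finite ?S" using finitely_many_partition_on[OF assms(1)] by simp
  then have "(\<Sum>Z | Z \<in> ?S \<and> saturated (join_rel P Q) A Z. cut_weight Z) =
      (\<Sum>Z\<in>?S. if saturated (join_rel P Q) A Z then cut_weight Z else 0)"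
    using sum.inter_filter[of ?S cut_weight "\<lambda>Z. saturated (join_rel P Q) A Z"] by simp
  also have "\<dots> = (\<Sum>Z\<in>?S.
       (if refines A P Z then 1 else 0) * ((if refines A Q Z then 1 else 0) * cut_weight Z))"
    using saturated_join_rel_iff[OF P Q] by (intro sum.cong) auto
  finally have eq: "(\<Sum>Z | partition_on A Z \<and> separates s t Z \<and> saturated (join_rel P Q) A Z. cut_weight Z) = \<dots>"
    by (simp add: conj_assoc)
  have "(\<Sum>Z | partition_on A Z \<and> separates s t Z \<and> saturated (join_rel P Q) A Z. cut_weight Z)
      = (if (s, t) \<in> join_rel P Q then 0 else 1)"
  proof (cases "(s, t) \<in> join_rel P Q")
    case False
    then show ?thesis
      using sum_cut_weight[OF assms(1-4) sym_join_rel trans_join_rel] by simp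
  next
    case True
    have "(partition_on A Z \<and> separates s t Z \<and> saturated (join_rel P Q) A Z) = False" for Z
    proof (rule iffI)
      assume Z: "partition_on A Z \<and> separates s t Z \<and> saturated (join_rel P Q) A Z"
      then obtain B where "B \<in> Z" "s \<in> B" using partition_onD1 assms(2) by blast
      then show False using Z True assms(3) unfolding separates_def saturated_def by blast
    qed simp
    then show ?thesis using True by (simp only: Collect_empty_eq) simp
  qed
  then show ?thesis using eq by simp
qed

section \<open>Nonsingularity of the disconnection matrix\<close>

text \<open>In the factorisation both outer factors are triangular for the refinement order with
  ones on the diagonal, and the middle one is diagonal without zeros. So \<open>c\<close> is
  cancelled out by two triangular inductions, one for each outer factor.\<close>

lemma disconnection_rows_independent:
  assumes A: "finite A" "s \<in> A" "t \<in> A" "s \<noteq> t"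
    and rel: "\<And>Q. partition_on A Q \<Longrightarrow> separates s t Q \<Longrightarrow>
      (\<Sum>P | partition_on A P \<and> separates s t P. c P * (if (s, t) \<in> join_rel P Q then 0 else 1)) = (0::real)"
    and P: "partition_on A P" "separates s t P"
  shows "c P = 0"
proof -
  let ?S = "{Z. partition_on A Z \<and> separates s t Z}"
  have fin: "finite ?S" using finitely_many_partition_on[OF A(1)] by simp
  \<comment> \<open>\<open>S\<close> is the row vector \<open>c\<close> times the refinement
    matrix.\<close>
  define S where "S Z = (\<Sum>P\<in>?S. c P * (if refines A P Z then 1 else 0))" for Z
  have SZ: "(\<Sum>Z\<in>?S. (if refines A Q Z then 1 else 0) * cut_weight Z * S Z) = 0" if Q: "Q \<in> ?S" for Q
  proof -
    have "0 = (\<Sum>P\<in>?S. c P * (\<Sum>Z\<in>?S.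
       (if refines A P Z then 1 else 0) * ((if refines A Q Z then 1 else 0) * cut_weight Z)))"
      using rel[of Q] Q disconnected_eq_sum_cut_weight[OF A, of _ Q] by simp
    also have "\<dots> = (\<Sum>P\<in>?S. \<Sum>Z\<in>?S. c P *
       ((if refines A P Z then 1 else 0) * ((if refines A Q Z then 1 else 0) * cut_weight Z)))"
      by (simp only: sum_distrib_left)
    also have "\<dots> = (\<Sum>Z\<in>?S. \<Sum>P\<in>?S. c P *
       ((if refines A P Z then 1 else 0) * ((if refines A Q Z then 1 else 0) * cut_weight Z)))"
      by (rule sum.swap)
    also have "\<dots> = (\<Sum>Z\<in>?S. (if refines A Q Z then 1 else 0) * cut_weight Z * S Z)"
      unfolding S_def sum_distrib_left by (intro sum.cong refl) (simp add: mult_ac)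
    finally show ?thesis by simp
  qed
  \<comment> \<open>The number of coarser partitions drops strictly when passing to a proper
    coarsening; it is the induction measure for \<open>S\<close>.\<close>
  have up: "Z = Q \<or> card {Z'\<in>?S. refines A Z Z'} < card {Z'\<in>?S. refines A Q Z'}"
    if "Z \<in> ?S" "Q \<in> ?S" "refines A Q Z" for Q Z
  proof (cases "refines A Z Q")
    case True
    then show ?thesis using refines_asym that by blast
  next
    case False
    have "{Z'\<in>?S. refines A Z Z'} \<subseteq> {Z'\<in>?S. refines A Q Z'}"
      using that refines_trans by blast
    moreover have "Q \<in> {Z'\<in>?S. refines A Q Z'}" "Q \<notin> {Z'\<in>?S. refines A Z Z'}"
      using that False refines_refl[of A Q] by auto
    ultimately have "{Z'\<in>?S. refines A Z Z'} \<subset> {Z'\<in>?S. refines A Q Z'}" by blast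
    then show ?thesis using fin by (intro disjI2 psubset_card_mono) (auto intro: finite_subset[OF _ fin])
  qed
  have S0: "S Q = 0" if "Q \<in> ?S" for Q
    using that
  proof (induction "card {Z'\<in>?S. refines A Q Z'}" arbitrary: Q rule: less_induct)
    case less
    have "(\<Sum>Z\<in>?S. (if refines A Q Z then 1 else 0) * cut_weight Z * S Z)
        = (\<Sum>Z\<in>?S. if Z = Q then cut_weight Q * S Q else 0)"
    proof (rule sum.cong[OF refl])
      fix Z assume Z: "Z \<in> ?S"
      show "(if refines A Q Z then 1 else 0) * cut_weight Z * S Z = (if Z = Q then cut_weight Q * S Q else 0)"
      proof (cases "Z = Q")
        case True
        then show ?thesis using Z by (simp add: refines_refl)
      next
        case False
        have "S Z = 0" if "refines A Q Z"
          by (rule less.hyps) (use up[OF Z less.prems that] False Z in auto)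
        then show ?thesis using False by auto
      qed
    qed
    then have "cut_weight Q * S Q = 0" using SZ[OF less.prems] less.prems fin by simp
    then show ?case by (simp add: cut_weight_nonzero)
  qed
  have down: "Z = Q \<or> card {Z'\<in>?S. refines A Z' Z} < card {Z'\<in>?S. refines A Z' Q}"
    if "Z \<in> ?S" "Q \<in> ?S" "refines A Z Q" for Q Z
  proof (cases "refines A Q Z")
    case True
    then show ?thesis using refines_asym that by blast
  next
    case False
    have "{Z'\<in>?S. refines A Z' Z} \<subseteq> {Z'\<in>?S. refines A Z' Q}"
      using that refines_trans by blast
    moreover have "Q \<in> {Z'\<in>?S. refines A Z' Q}" "Q \<notin> {Z'\<in>?S. refines A Z' Z}"
      using that False refines_refl[of A Q] by auto
    ultimately have "{Z'\<in>?S. refines A Z' Z} \<subset> {Z'\<in>?S. refines A Z' Q}" by blast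
    then show ?thesis using fin by (intro disjI2 psubset_card_mono) (auto intro: finite_subset[OF _ fin])
  qed
  \<comment> \<open>The second induction goes in the other direction: \<open>S Q\<close> sums
    \<open>c\<close> over refinements of \<open>Q\<close>, and all proper ones already have
    coefficient 0.\<close>
  have "c Q = 0" if "Q \<in> ?S" for Q
    using that
  proof (induction "card {Z'\<in>?S. refines A Z' Q}" arbitrary: Q rule: less_induct)
    case less
    have "S Q = (\<Sum>Z\<in>?S. if Z = Q then c Q else 0)"
      unfolding S_def
    proof (rule sum.cong[OF refl])
      fix Z assume Z: "Z \<in> ?S"
      show "c Z * (if refines A Z Q then 1 else 0) = (if Z = Q then c Q else 0)"
      proof (cases "Z = Q")
        case True
        then show ?thesis using Z by (simp add: refines_refl)
      next
        case False
        have "c Z = 0" if "refines A Z Q"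
          by (rule less.hyps) (use down[OF Z less.prems that] False Z in auto)
        then show ?thesis using False by auto
      qed
    qed
    then show ?case using S0[OF less.prems] less.prems fin by simp
  qed
  then show ?thesis using P by blast
qed

subsection \<open>The rank bound for protocols\<close>

text \<open>Gaussian elimination: if some unknown \<open>z\<close> occurs in the last equation, it
  is solved for and substituted into the others, leaving one equation and one unknown fewer.\<close>

lemma nontrivial_solution_exists:
  fixes \<alpha> :: "'x \<Rightarrow> nat \<Rightarrow> real"
  assumes "finite X" "N < card X"
  shows "\<exists>c. (\<exists>x\<in>X. c x \<noteq> 0) \<and> (\<forall>i<N. (\<Sum>x\<in>X. c x * \<alpha> x i) = 0)"
  using assms
proof (induction N arbitrary: X \<alpha>)
  case 0
  then obtain x where "x \<in> X" by fastforce
  then show ?case by (intro exI[of _ "\<lambda>_. 1"]) auto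
next
  case (Suc N)
  show ?case
  proof (cases "\<forall>x\<in>X. \<alpha> x N = 0")
    case True
    obtain c where c: "\<exists>x\<in>X. c x \<noteq> 0" "\<forall>i<N. (\<Sum>x\<in>X. c x * \<alpha> x i) = 0"
      using Suc.IH[of X \<alpha>] Suc.prems by auto
    moreover have "(\<Sum>x\<in>X. c x * \<alpha> x N) = 0" using True by simp
    ultimately show ?thesis by (metis less_Suc_eq)
  next
    case False
    then obtain z where z: "z \<in> X" "\<alpha> z N \<noteq> 0" by auto
    let ?X = "X - {z}"
    define r where "r x = \<alpha> x N / \<alpha> z N" for x
    have "finite ?X" "N < card ?X" using Suc.prems z by auto
    then obtain c where c: "\<exists>x\<in>?X. c x \<noteq> 0"
        "\<forall>i<N. (\<Sum>x\<in>?X. c x * (\<alpha> x i - r x * \<alpha> z i)) = 0"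
      using Suc.IH[of ?X "\<lambda>x i. \<alpha> x i - r x * \<alpha> z i"] by auto
    \<comment> \<open>This value of the unknown \<open>z\<close> turns each original equation into
      its reduced form; the last one reduces to \<open>0 = 0\<close>.\<close>
    define d where "d = c(z := - (\<Sum>x\<in>?X. c x * r x))"
    have "(\<Sum>x\<in>X. d x * \<alpha> x i) = (\<Sum>x\<in>?X. c x * (\<alpha> x i - r x * \<alpha> z i))" for i
    proof -
      have "(\<Sum>x\<in>X. d x * \<alpha> x i) = d z * \<alpha> z i + (\<Sum>x\<in>?X. d x * \<alpha> x i)"
        using Suc.prems z by (simp add: sum.remove)
      also have "(\<Sum>x\<in>?X. d x * \<alpha> x i) = (\<Sum>x\<in>?X. c x * \<alpha> x i)"
        by (intro sum.cong) (auto simp: d_def)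
      also have "d z * \<alpha> z i + \<dots> = (\<Sum>x\<in>?X. c x * (\<alpha> x i - r x * \<alpha> z i))"
        by (simp add: d_def sum_distrib_left sum_subtractf algebra_simps)
      finally show ?thesis .
    qed
    moreover have "(\<Sum>x\<in>?X. c x * (\<alpha> x N - r x * \<alpha> z N)) = 0"
      using z by (simp add: r_def)
    ultimately have "\<forall>i<Suc N. (\<Sum>x\<in>X. d x * \<alpha> x i) = 0"
      using c(2) by (metis less_Suc_eq)
    moreover have "\<exists>x\<in>X. d x \<noteq> 0" using c(1) by (auto simp: d_def)
    ultimately show ?thesis by blast
  qed
qed

lemma sum_lessThan_add:
  fixes f g :: "nat \<Rightarrow> real"
  shows "(\<Sum>i<M + N. if i < M then f i else g (i - M)) = (\<Sum>i<M. f i) + (\<Sum>i<N. g i)"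
  by (induction N) (auto simp: add.assoc)

text \<open>A bit of Alice splits the matrix into two sets of rows, a bit of Bob into two sets of
  columns. The matrix is the sum of the two parts padded with zeros, so each bit at most doubles the
  rank, and a leaf gives a constant matrix.\<close>

lemma outcome_low_rank:
  fixes \<phi> :: "'z \<Rightarrow> real"
  assumes "\<And>x y. x \<in> X \<Longrightarrow> y \<in> Y \<Longrightarrow> bits P x y \<le> d"
  shows "\<exists>\<alpha> \<beta>. \<forall>x\<in>X. \<forall>y\<in>Y. \<phi> (outcome P x y) = (\<Sum>i<(2::nat) ^ d. \<alpha> x i * \<beta> i y)"
  using assms
proof (induction P arbitrary: X Y d)
  case (Output z)
  have "(\<Sum>i<(2::nat) ^ d. (if i = 0 then \<phi> z else 0) * 1) = \<phi> z" by simp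
  then show ?case
    by (intro exI[of _ "\<lambda>x i. if i = (0::nat) then \<phi> z else 0"] exI[of _ "\<lambda>i y. 1"]) simp
next
  case (Alice f P Q)
  show ?case
  proof (cases "X = {} \<or> Y = {}")
    case True
    then show ?thesis by auto
  next
    case False
    \<comment> \<open>An actual input pair costs at least one bit here, so \<open>d\<close> is
      positive; with no input pair the cost bound would be vacuous.\<close>
    then obtain e where d: "d = Suc e" using Alice.prems by (cases d) fastforce+
    have "bits P x y \<le> e" if "x \<in> {x\<in>X. f x}" "y \<in> Y" for x y
      using Alice.prems[of x y] that d by simp
    then obtain \<alpha>1 \<beta>1 where 1: "\<forall>x\<in>{x\<in>X. f x}. \<forall>y\<in>Y. \<phi> (outcome P x y) = (\<Sum>i<(2::nat) ^ e. \<alpha>1 x i * \<beta>1 i y)"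
      using Alice.IH(1)[of "{x\<in>X. f x}" Y e] by blast
    have "bits Q x y \<le> e" if "x \<in> {x\<in>X. \<not> f x}" "y \<in> Y" for x y
      using Alice.prems[of x y] that d by simp
    then obtain \<alpha>2 \<beta>2 where 2: "\<forall>x\<in>{x\<in>X. \<not> f x}. \<forall>y\<in>Y. \<phi> (outcome Q x y) = (\<Sum>i<(2::nat) ^ e. \<alpha>2 x i * \<beta>2 i y)"
      using Alice.IH(2)[of "{x\<in>X. \<not> f x}" Y e] by blast
    \<comment> \<open>The first \<open>2 ^ e\<close> terms serve the rows with \<open>f x\<close>,
      the rest the other rows; zeros switch off the wrong half.\<close>
    define \<alpha> where "\<alpha> x i = (if i < (2::nat) ^ e then if f x then \<alpha>1 x i else 0
        else if f x then 0 else \<alpha>2 x (i - 2 ^ e))" for x i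
    define \<beta> where "\<beta> i y = (if i < (2::nat) ^ e then \<beta>1 i y else \<beta>2 (i - 2 ^ e) y)" for i y
    have "\<phi> (outcome (Alice f P Q) x y) = (\<Sum>i<(2::nat) ^ d. \<alpha> x i * \<beta> i y)" if xy: "x \<in> X" "y \<in> Y" for x y
    proof -
      have "(\<Sum>i<(2::nat) ^ d. \<alpha> x i * \<beta> i y) = (\<Sum>i<2 ^ e + 2 ^ e.
          if i < 2 ^ e then (if f x then \<alpha>1 x i else 0) * \<beta>1 i y
          else (if f x then 0 else \<alpha>2 x (i - 2 ^ e)) * \<beta>2 (i - 2 ^ e) y)"
        unfolding d by (intro sum.cong) (auto simp: \<alpha>_def \<beta>_def)
      also have "\<dots> = (\<Sum>i<2 ^ e. (if f x then \<alpha>1 x i else 0) * \<beta>1 i y) +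
          (\<Sum>i<2 ^ e. (if f x then 0 else \<alpha>2 x i) * \<beta>2 i y)"
        by (rule sum_lessThan_add)
      also have "\<dots> = \<phi> (outcome (Alice f P Q) x y)" using 1 2 xy by simp
      finally show ?thesis by simp
    qed
    then show ?thesis by blast
  qed
next
  case (Bob g P Q)
  show ?case
  proof (cases "X = {} \<or> Y = {}")
    case True
    then show ?thesis by auto
  next
    case False
    then obtain e where d: "d = Suc e" using Bob.prems by (cases d) fastforce+
    have "bits P x y \<le> e" if "x \<in> X" "y \<in> {y\<in>Y. g y}" for x y
      using Bob.prems[of x y] that d by simp
    then obtain \<alpha>1 \<beta>1 where 1: "\<forall>x\<in>X. \<forall>y\<in>{y\<in>Y. g y}. \<phi> (outcome P x y) = (\<Sum>i<(2::nat) ^ e. \<alpha>1 x i * \<beta>1 i y)"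
      using Bob.IH(1)[of X "{y\<in>Y. g y}" e] by blast
    have "bits Q x y \<le> e" if "x \<in> X" "y \<in> {y\<in>Y. \<not> g y}" for x y
      using Bob.prems[of x y] that d by simp
    then obtain \<alpha>2 \<beta>2 where 2: "\<forall>x\<in>X. \<forall>y\<in>{y\<in>Y. \<not> g y}. \<phi> (outcome Q x y) = (\<Sum>i<(2::nat) ^ e. \<alpha>2 x i * \<beta>2 i y)"
      using Bob.IH(2)[of X "{y\<in>Y. \<not> g y}" e] by blast
    define \<alpha> where "\<alpha> x i = (if i < (2::nat) ^ e then \<alpha>1 x i else \<alpha>2 x (i - 2 ^ e))" for x i
    define \<beta> where "\<beta> i y = (if i < (2::nat) ^ e then if g y then \<beta>1 i y else 0
        else if g y then 0 else \<beta>2 (i - 2 ^ e) y)" for i y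
    have "\<phi> (outcome (Bob g P Q) x y) = (\<Sum>i<(2::nat) ^ d. \<alpha> x i * \<beta> i y)" if xy: "x \<in> X" "y \<in> Y" for x y
    proof -
      have "(\<Sum>i<(2::nat) ^ d. \<alpha> x i * \<beta> i y) = (\<Sum>i<2 ^ e + 2 ^ e.
          if i < 2 ^ e then \<alpha>1 x i * (if g y then \<beta>1 i y else 0)
          else \<alpha>2 x (i - 2 ^ e) * (if g y then 0 else \<beta>2 (i - 2 ^ e) y))"
        unfolding d by (intro sum.cong) (auto simp: \<alpha>_def \<beta>_def)
      also have "\<dots> = (\<Sum>i<2 ^ e. \<alpha>1 x i * (if g y then \<beta>1 i y else 0)) +
          (\<Sum>i<2 ^ e. \<alpha>2 x i * (if g y then 0 else \<beta>2 i y))"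
        by (rule sum_lessThan_add)
      also have "\<dots> = \<phi> (outcome (Bob g P Q) x y)" using 1 2 xy by simp
      finally show ?thesis by simp
    qed
    then show ?thesis by blast
  qed
qed

text \<open>With more than \<open>2 ^ d\<close> rows, some nontrivial combination annihilates all
  left factors of the low-rank decomposition and hence all columns, against independence.\<close>

lemma independent_rows_card_le:
  fixes \<phi> :: "'z \<Rightarrow> real" and a :: "'i \<Rightarrow> 'x"
  assumes "finite I"
    and bits: "\<And>i j. i \<in> I \<Longrightarrow> j \<in> J \<Longrightarrow> bits P (a i) (b j) \<le> d"
    and indep: "\<And>c i. (\<And>j. j \<in> J \<Longrightarrow> (\<Sum>i\<in>I. c i * \<phi> (outcome P (a i) (b j))) = 0) \<Longrightarrow> i \<in> I \<Longrightarrow> c i = 0"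
  shows "card I \<le> 2 ^ d"
proof (rule ccontr)
  assume "\<not> card I \<le> 2 ^ d"
  have "bits P x y \<le> d" if "x \<in> a ` I" "y \<in> b ` J" for x y
    using that bits by blast
  then obtain \<alpha> \<beta> where ab: "\<forall>x\<in>a ` I. \<forall>y\<in>b ` J. \<phi> (outcome P x y) = (\<Sum>k<(2::nat) ^ d. \<alpha> x k * \<beta> k y)"
    using outcome_low_rank[of "a ` I" "b ` J" P d \<phi>] by blast
  obtain c where c: "\<exists>i\<in>I. c i \<noteq> 0" "\<forall>k<2 ^ d. (\<Sum>i\<in>I. c i * \<alpha> (a i) k) = 0"
    using nontrivial_solution_exists[OF assms(1), of "2 ^ d" "\<lambda>i. \<alpha> (a i)"] \<open>\<not> card I \<le> 2 ^ d\<close>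
    by (auto simp: not_le)
  have "(\<Sum>i\<in>I. c i * \<phi> (outcome P (a i) (b j))) = 0" if "j \<in> J" for j
  proof -
    have "(\<Sum>i\<in>I. c i * \<phi> (outcome P (a i) (b j))) = (\<Sum>i\<in>I. \<Sum>k<2 ^ d. c i * \<alpha> (a i) k * \<beta> k (b j))"
      using ab that by (intro sum.cong) (auto simp: sum_distrib_left mult.assoc)
    also have "\<dots> = (\<Sum>k<2 ^ d. (\<Sum>i\<in>I. c i * \<alpha> (a i) k) * \<beta> k (b j))"
      by (subst sum.swap) (simp add: sum_distrib_right)
    also have "\<dots> = 0" using c(2) by simp
    finally show ?thesis .
  qed
  then show False using indep c(1) by blast
qed

subsection \<open>Connectivity as matroid intersection\<close>

lemma card_eq_sum_fibres:
  assumes "finite T" "finite P" "partition_on K P" "f ` T \<subseteq> K"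
  shows "card T = (\<Sum>C\<in>P. card {x\<in>T. f x \<in> C})"
proof -
  have "T = (\<Union>C\<in>P. {x\<in>T. f x \<in> C})" using assms(4) partition_onD1[OF assms(3)] by auto
  then have "card T = card (\<Union>C\<in>P. {x\<in>T. f x \<in> C})" by simp
  also have "\<dots> = (\<Sum>C\<in>P. card {x\<in>T. f x \<in> C})"
    using assms(1,2) partition_on_disjoint[OF assms(3)] by (intro card_UN_disjoint) auto
  finally show ?thesis .
qed

text \<open>A partition matroid on two copies of the points, both copies counting towards the same
  block. The second copy lets a point be used twice, as when \<open>{t}\<close> is a block of Bob
  with capacity 2.\<close>

definition block_indep :: "'v set set \<Rightarrow> ('v set \<Rightarrow> nat) \<Rightarrow> ('v \<times> bool) set set" where
  "block_indep P cap = {T. T \<subseteq> \<Union>P \<times> UNIV \<and> (\<forall>C\<in>P. card {x\<in>T. fst x \<in> C} \<le> cap C)}"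

lemma matroid_block_indep:
  assumes V: "finite V" and P: "partition_on V P"
  shows "matroid (V \<times> UNIV) (block_indep P cap)"
proof
  have UP: "\<Union>P = V" using partition_onD1[OF P] by simp
  have finT: "finite T" if "T \<in> block_indep P cap" for T
    using that V finite_subset[of T "V \<times> UNIV"] by (simp add: block_indep_def UP)
  show "finite (V \<times> (UNIV :: bool set))" using V by simp
  show "block_indep P cap \<subseteq> Pow (V \<times> UNIV)" by (auto simp: block_indep_def UP)
  show "{} \<in> block_indep P cap" by (simp add: block_indep_def)
  show "X \<in> block_indep P cap" if Y: "Y \<in> block_indep P cap" and "X \<subseteq> Y" for X Y
  proof -
    have "card {x\<in>X. fst x \<in> C} \<le> card {x\<in>Y. fst x \<in> C}" for C
      using finT[OF Y] \<open>X \<subseteq> Y\<close> by (intro card_mono) auto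
    then show ?thesis using Y \<open>X \<subseteq> Y\<close> unfolding block_indep_def by (blast intro: order_trans)
  qed
  show "\<exists>e\<in>Y - X. insert e X \<in> block_indep P cap"
    if X: "X \<in> block_indep P cap" and Y: "Y \<in> block_indep P cap" and less: "card X < card Y" for X Y
  proof -
    have sum: "card T = (\<Sum>C\<in>P. card {x\<in>T. fst x \<in> C})" if "T \<in> block_indep P cap" for T
      using that finT[OF that] finite_elements[OF V P] P
      by (intro card_eq_sum_fibres) (auto simp: block_indep_def UP)
    \<comment> \<open>Some block holds more of \<open>Y\<close> than of \<open>X\<close>; there
      \<open>X\<close> is below capacity, and any element of \<open>Y - X\<close> in that block can
      be added.\<close>
    obtain C where C: "C \<in> P" "card {x\<in>X. fst x \<in> C} < card {x\<in>Y. fst x \<in> C}"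
      using less unfolding sum[OF X] sum[OF Y] by (meson linorder_not_le sum_mono)
    then have "\<not> {x\<in>Y. fst x \<in> C} \<subseteq> {x\<in>X. fst x \<in> C}"
      using finT[OF X] card_mono[of "{x\<in>X. fst x \<in> C}" "{x\<in>Y. fst x \<in> C}"] by auto
    then obtain e where e: "e \<in> Y" "e \<notin> X" "fst e \<in> C" by auto
    have "card {x\<in>insert e X. fst x \<in> D} \<le> cap D" if D: "D \<in> P" for D
    proof (cases "D = C")
      case True
      have "{x\<in>insert e X. fst x \<in> C} = insert e {x\<in>X. fst x \<in> C}" using e by auto
      then have "card {x\<in>insert e X. fst x \<in> C} \<le> card {x\<in>Y. fst x \<in> C}"
        using C e finT[OF X] by simp
      then show ?thesis using Y C(1) True unfolding block_indep_def by fastforce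
    next
      case False
      then have "fst e \<notin> D" using partition_on_disjoint[OF P D C(1)] e by blast
      then have "{x\<in>insert e X. fst x \<in> D} = {x\<in>X. fst x \<in> D}" by auto
      then show ?thesis using X D by (simp add: block_indep_def)
    qed
    then have "insert e X \<in> block_indep P cap"
      using X Y e by (auto simp: block_indep_def)
    then show ?thesis using e by blast
  qed
qed

text \<open>This transports the construction to an arbitrary ground set; points outside the image
  become loops.\<close>

lemma matroid_image:
  assumes "matroid E I" and f: "inj_on f E" "f ` E \<subseteq> U" and U: "finite U"
  shows "matroid U ((`) f ` I)"
proof -
  interpret matroid E I by fact
  have inj: "inj_on f T" if "T \<in> I" for T
    using that indep_subset f(1) by (auto intro: inj_on_subset)
  show ?thesis
  proof
    show "finite U" by fact
    show "(`) f ` I \<subseteq> Pow U" using indep_subset f(2) by blast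
    show "{} \<in> (`) f ` I" using empty_indep by force
    show "X \<in> (`) f ` I" if Y: "Y \<in> (`) f ` I" and X: "X \<subseteq> Y" for X Y
      using Y X hereditary by (auto simp: subset_image_iff)
    show "\<exists>e\<in>Y - X. insert e X \<in> (`) f ` I"
      if XY: "X \<in> (`) f ` I" "Y \<in> (`) f ` I" "card X < card Y" for X Y
    proof -
      obtain S T where S: "S \<in> I" "X = f ` S" and T: "T \<in> I" "Y = f ` T" using XY by auto
      have "card S < card T" using XY(3) S T by (simp add: card_image inj)
      then obtain e where e: "e \<in> T" "e \<notin> S" "insert e S \<in> I" using augmentation S T by blast
      have "f e \<notin> X" using inj[OF e(3)] e(2) S(2) by (simp add: inj_on_insert)
      then show ?thesis using e S T by (metis DiffI image_eqI image_insert)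
    qed
  qed
qed

text \<open>
  With these capacities for Bob and \<^const>\<open>card\<close> for Alice, both matroids have rank at most
  \<open>card V\<close>, and a common independent set of that size must carry one unit from \<open>s\<close> to \<open>t\<close>.
\<close>

definition shifted_cap :: "'v \<Rightarrow> 'v \<Rightarrow> 'v set \<Rightarrow> nat" where
  "shifted_cap s t D = card (D - {s}) + (if t \<in> D then 1 else 0)"

lemma partition_on_saturated_subset:
  assumes "partition_on V P" "K \<subseteq> V" "block_rel P `` K \<subseteq> K"
  shows "partition_on K {C\<in>P. C \<subseteq> K}"
proof (rule partition_onI)
  show "\<Union>{C\<in>P. C \<subseteq> K} = K"
  proof
    show "K \<subseteq> \<Union>{C\<in>P. C \<subseteq> K}"
    proof
      fix x assume x: "x \<in> K"
      then obtain C where C: "C \<in> P" "x \<in> C" using assms(2) partition_onD1[OF assms(1)] by blast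
      then have "C \<subseteq> block_rel P `` K" using x by (auto simp: block_rel_def)
      then show "x \<in> \<Union>{C\<in>P. C \<subseteq> K}" using C assms(3) by blast
    qed
  qed auto
  show "disjnt p q" if "p \<in> {C\<in>P. C \<subseteq> K}" "q \<in> {C\<in>P. C \<subseteq> K}" "p \<noteq> q" for p q
    using that partition_on_disjoint[OF assms(1)] by (auto simp: disjnt_iff)
  show "{} \<notin> {C\<in>P. C \<subseteq> K}" using partition_onD3[OF assms(1)] by simp
qed

text \<open>A cut argument. Let \<open>K\<close> be the component of \<open>s\<close> and suppose
  \<open>t\<close> lies outside it. Bob's capacities allow at most \<open>card K - 1\<close>
  elements over \<open>K\<close>, since one unit left and none came in, and Alice's at most
  \<open>card (V - K)\<close> over the rest. The total falls short of \<open>card V\<close>.\<close>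

lemma common_indep_imp_connected:
  assumes V: "finite V" "s \<in> V" and P: "partition_on V P" and Q: "partition_on V Q"
    and T: "T \<in> block_indep P card" "T \<in> block_indep Q (shifted_cap s t)" "card T = card V"
  shows "(s, t) \<in> join_rel P Q"
proof (rule ccontr)
  assume nst: "(s, t) \<notin> join_rel P Q"
  define K where "K = join_rel P Q `` {s}"
  have sub: "block_rel P \<subseteq> V \<times> V" "block_rel Q \<subseteq> V \<times> V"
    using partition_onD1[OF P] partition_onD1[OF Q] by (auto simp: block_rel_def)
  have bj: "block_rel P \<union> block_rel Q \<subseteq> join_rel P Q" by (auto simp: join_rel_def)
  have "join_rel P Q \<subseteq> V \<times> V"
    unfolding join_rel_def using sub by (intro trancl_subset_Sigma) auto
  then have KV: "K \<subseteq> V" by (auto simp: K_def)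
  have "(s, s) \<in> block_rel P" using V(2) partition_onD1[OF P] by (auto simp: block_rel_def)
  then have sK: "s \<in> K" using bj by (auto simp: K_def)
  have tK: "t \<notin> K" using nst by (simp add: K_def)
  have closed: "y \<in> K" if "x \<in> K" "(x, y) \<in> join_rel P Q" for x y
    using that transD[OF trans_join_rel] by (auto simp: K_def)
  have "block_rel Q `` K \<subseteq> K" using closed bj by blast
  then have QK: "partition_on K {D\<in>Q. D \<subseteq> K}"
    by (rule partition_on_saturated_subset[OF Q KV])
  have "block_rel P `` (V - K) \<subseteq> V - K"
  proof
    fix y assume "y \<in> block_rel P `` (V - K)"
    then obtain x where x: "x \<in> V" "x \<notin> K" "(x, y) \<in> block_rel P" by auto
    then have "(y, x) \<in> join_rel P Q" using bj by (auto simp: block_rel_def)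
    then show "y \<in> V - K" using closed[of y x] x sub by auto
  qed
  then have PK: "partition_on (V - K) {C\<in>P. C \<subseteq> V - K}"
    by (intro partition_on_saturated_subset[OF P]) auto
  have finP: "finite P" "finite Q" using finite_elements[OF V(1)] P Q by auto
  have finK: "finite K" using KV V(1) finite_subset by blast
  have TV: "T \<subseteq> V \<times> UNIV" using T(1) partition_onD1[OF P] by (simp add: block_indep_def)
  have finT: "finite T" using finite_subset[OF TV] V(1) by simp
  have "card {x\<in>T. fst x \<in> K} = (\<Sum>D\<in>{D\<in>Q. D \<subseteq> K}. card {x\<in>{x\<in>T. fst x \<in> K}. fst x \<in> D})"
    by (rule card_eq_sum_fibres[OF _ _ QK]) (use finT finP in auto)
  \<comment> \<open>Written as fibres of the identity on \<open>K - {s}\<close>, Bob's capacities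
    are summed by the same counting lemma.\<close>
  also have "\<dots> \<le> (\<Sum>D\<in>{D\<in>Q. D \<subseteq> K}. card {x\<in>K - {s}. id x \<in> D})"
  proof (rule sum_mono)
    fix D assume D: "D \<in> {D\<in>Q. D \<subseteq> K}"
    then have "{x\<in>{x\<in>T. fst x \<in> K}. fst x \<in> D} = {x\<in>T. fst x \<in> D}"
      "{x\<in>K - {s}. id x \<in> D} = D - {s}" "t \<notin> D" using tK by auto
    then show "card {x\<in>{x\<in>T. fst x \<in> K}. fst x \<in> D} \<le> card {x\<in>K - {s}. id x \<in> D}"
      using T(2) D by (auto simp: block_indep_def shifted_cap_def)
  qed
  also have "\<dots> = card (K - {s})"
    by (rule card_eq_sum_fibres[OF _ _ QK, symmetric]) (use finK finP in auto)
  finally have 1: "card {x\<in>T. fst x \<in> K} < card K"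
    using sK finK by (metis card_Diff1_less le_less_trans)
  have "card {x\<in>T. fst x \<notin> K} = (\<Sum>C\<in>{C\<in>P. C \<subseteq> V - K}. card {x\<in>{x\<in>T. fst x \<notin> K}. fst x \<in> C})"
    by (rule card_eq_sum_fibres[OF _ _ PK]) (use finT finP TV in auto)
  also have "\<dots> \<le> (\<Sum>C\<in>{C\<in>P. C \<subseteq> V - K}. card C)"
  proof (rule sum_mono)
    fix C assume C: "C \<in> {C\<in>P. C \<subseteq> V - K}"
    then have "{x\<in>{x\<in>T. fst x \<notin> K}. fst x \<in> C} = {x\<in>T. fst x \<in> C}" by auto
    then show "card {x\<in>{x\<in>T. fst x \<notin> K}. fst x \<in> C} \<le> card C"
      using T(1) C by (auto simp: block_indep_def)
  qed
  also have "\<dots> = card (V - K)"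
    using PK V(1) by (intro product_partition[symmetric]) (auto intro: finite_subset)
  finally have 2: "card {x\<in>T. fst x \<notin> K} \<le> card (V - K)" .
  have "T = {x\<in>T. fst x \<in> K} \<union> {x\<in>T. fst x \<notin> K}" by auto
  then have "card T = card {x\<in>T. fst x \<in> K} + card {x\<in>T. fst x \<notin> K}"
    using finT by (metis (no_types, lifting) card_Un_disjoint disjoint_iff finite_Un mem_Collect_eq)
  moreover have "card V = card K + card (V - K)"
    using KV V(1) by (metis card_Diff_subset card_mono finK le_add_diff_inverse)
  ultimately show False using 1 2 T(3) by simp
qed

text \<open>
  Along a shortest walk \<open>s = y\<^sub>0, x\<^sub>1, y\<^sub>1, x\<^sub>2, \<dots>, y\<^sub>n = u\<close> alternating between
  blocks of \<open>P\<close> and \<open>Q\<close>, the \<open>x\<^sub>i\<close> are distinct and so are the \<open>y\<^sub>i\<close>; take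
  \<open>X = {x\<^sub>1, \<dots>, x\<^sub>n}\<close> and \<open>Y = {y\<^sub>0, \<dots>, y\<^bsub>n-1\<^esub>}\<close>.
\<close>

lemma alternating_path_sets:
  fixes P Q :: "'v set set"
  defines "R \<equiv> block_rel P O block_rel Q"
  assumes P: "partition_on V P" and Q: "partition_on V Q" and V: "finite V"
    and "(s, u) \<in> R ^^ n" "\<And>k. k < n \<Longrightarrow> (s, u) \<notin> R ^^ k"
  shows "\<exists>X Y. X \<subseteq> V \<and> Y \<subseteq> V \<and>
     (\<forall>C\<in>P. card (X \<inter> C) = card (Y \<inter> C)) \<and>
     (\<forall>D\<in>Q. card (X \<inter> D) + of_bool (s \<in> D) = card (Y \<inter> D) + of_bool (u \<in> D)) \<and>
     (\<forall>x\<in>X. \<exists>k<n. (s, x) \<in> R ^^ k O block_rel P) \<and> (\<forall>y\<in>Y. \<exists>k<n. (s, y) \<in> R ^^ k)"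
  using assms(5-)
proof (induction n arbitrary: u)
  case 0
  then show ?case by (intro exI[of _ "{}"]) auto
next
  case (Suc n)
  obtain w where w: "(s, w) \<in> R ^^ n" "(w, u) \<in> R" using Suc.prems(1) by auto
  then obtain v where v: "(w, v) \<in> block_rel P" "(v, u) \<in> block_rel Q" by (auto simp: R_def)
  \<comment> \<open>A shorter walk to \<open>w\<close> or to \<open>v\<close> would yield a shorter
    walk to \<open>u\<close>. So the prefix is shortest too, and both new points are fresh.\<close>
  have wnew: "(s, w) \<notin> R ^^ k" if "k < n" for k
    using Suc.prems(2)[of "Suc k"] that w(2) by auto
  have vnew: "(s, v) \<notin> R ^^ k O block_rel P" if "k < n" for k
  proof
    assume "(s, v) \<in> R ^^ k O block_rel P"
    then have "(s, u) \<in> R ^^ k O (block_rel P O block_rel Q)" using v(2) by blast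
    then have "(s, u) \<in> R ^^ Suc k" by (simp add: R_def)
    then show False using Suc.prems(2)[of "Suc k"] that by simp
  qed
  obtain X Y where XY: "X \<subseteq> V" "Y \<subseteq> V"
     "\<forall>C\<in>P. card (X \<inter> C) = card (Y \<inter> C)"
     "\<forall>D\<in>Q. card (X \<inter> D) + of_bool (s \<in> D) = card (Y \<inter> D) + of_bool (w \<in> D)"
     "\<forall>x\<in>X. \<exists>k<n. (s, x) \<in> R ^^ k O block_rel P" "\<forall>y\<in>Y. \<exists>k<n. (s, y) \<in> R ^^ k"
    using Suc.IH[OF w(1)] wnew by blast
  have fin: "finite X" "finite Y" using XY V finite_subset by blast+
  have new: "v \<notin> X" "w \<notin> Y" using XY(5,6) vnew wnew by blast+
  have card_ins: "card (insert z Z \<inter> C) = card (Z \<inter> C) + of_bool (z \<in> C)"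
    if "finite Z" "z \<notin> Z" for z :: 'v and Z C
    using that by (cases "z \<in> C") (auto simp: Int_insert_left)
  have vV: "v \<in> V" "w \<in> V" using v(1) partition_onD1[OF P] by (auto simp: block_rel_def)
  \<comment> \<open>Since \<open>v\<close> and \<open>w\<close> share a block of \<open>P\<close>,
    the balance there is kept; since \<open>v\<close> and \<open>u\<close> share a block of
    \<open>Q\<close>, the surplus there moves from \<open>w\<close> to \<open>u\<close>.\<close>
  have vwC: "v \<in> C \<longleftrightarrow> w \<in> C" if "C \<in> P" for C
    using that v(1) partition_on_disjoint[OF P] by (auto simp: block_rel_def)
  have vuD: "v \<in> D \<longleftrightarrow> u \<in> D" if "D \<in> Q" for D
    using that v(2) partition_on_disjoint[OF Q] by (auto simp: block_rel_def)
  have svw: "(s, v) \<in> R ^^ n O block_rel P" using w(1) v(1) by blast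
  show ?case
  proof (rule exI[of _ "insert v X"], rule exI[of _ "insert w Y"], intro conjI)
    show "insert v X \<subseteq> V" "insert w Y \<subseteq> V" using vV XY by auto
    show "\<forall>C\<in>P. card (insert v X \<inter> C) = card (insert w Y \<inter> C)"
      using XY(3) vwC by (simp add: card_ins fin new)
    show "\<forall>D\<in>Q. card (insert v X \<inter> D) + of_bool (s \<in> D) = card (insert w Y \<inter> D) + of_bool (u \<in> D)"
      using XY(4) vuD by (auto simp: card_ins fin new)
    show "\<forall>x\<in>insert v X. \<exists>k<Suc n. (s, x) \<in> R ^^ k O block_rel P"
      using XY(5) svw less_SucI by blast
    show "\<forall>y\<in>insert w Y. \<exists>k<Suc n. (s, y) \<in> R ^^ k"
      using XY(6) w(1) less_SucI by blast
  qed
qed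

text \<open>Start from the first copy of \<open>V\<close>, remove \<open>Y\<close> and add the
  second copy of \<open>X\<close>. The counts in blocks of \<open>P\<close> are unchanged, and those
  in blocks of \<open>Q\<close> move one unit from the block of \<open>s\<close> to that of
  \<open>t\<close>.\<close>

lemma connected_imp_common_indep:
  fixes V :: "'v set"
  assumes V: "finite V" and P: "partition_on V P" and Q: "partition_on V Q"
    and st: "(s, t) \<in> join_rel P Q"
  shows "\<exists>T. T \<in> block_indep P card \<and> T \<in> block_indep Q (shifted_cap s t) \<and> card T = card V"
proof -
  define R where "R = block_rel P O block_rel Q"
  have UP: "\<Union>P = V" "\<Union>Q = V" using partition_onD1[OF P] partition_onD1[OF Q] by auto
  have refl: "(x, x) \<in> block_rel P" "(x, x) \<in> block_rel Q" if "x \<in> V" for x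
    using that UP by (auto simp: block_rel_def)
  \<comment> \<open>By reflexivity on \<open>V\<close> each single step is also an alternating
    double step, so alternating walks reach whatever the join reaches.\<close>
  have "block_rel P \<union> block_rel Q \<subseteq> R"
  proof
    fix p assume p: "p \<in> block_rel P \<union> block_rel Q"
    obtain x y where xy: "p = (x, y)" by (cases p)
    have "x \<in> V" "y \<in> V" using p UP by (auto simp: xy block_rel_def)
    then show "p \<in> R" using p refl[of x] refl[of y] unfolding xy R_def by blast
  qed
  then have "join_rel P Q \<subseteq> R\<^sup>*"
    unfolding join_rel_def using rtrancl_mono[of "block_rel P \<union> block_rel Q" R]
    by (auto dest: trancl_into_rtrancl)
  then obtain n where n: "(s, t) \<in> R ^^ n" using st rtrancl_imp_relpow by blast
  define m where "m = (LEAST k. (s, t) \<in> R ^^ k)"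
  have "(s, t) \<in> R ^^ m" unfolding m_def using n by (rule LeastI)
  moreover have "\<And>k. k < m \<Longrightarrow> (s, t) \<notin> R ^^ k" unfolding m_def by (rule not_less_Least)
  ultimately obtain X Y where XY: "X \<subseteq> V" "Y \<subseteq> V"
     "\<forall>C\<in>P. card (X \<inter> C) = card (Y \<inter> C)"
     "\<forall>D\<in>Q. card (X \<inter> D) + of_bool (s \<in> D) = card (Y \<inter> D) + of_bool (t \<in> D)"
    using alternating_path_sets[OF P Q V, of s t m] unfolding R_def by blast
  \<comment> \<open>\<open>X\<close> and \<open>V - Y\<close> may overlap, hence the different
    tags.\<close>
  define T where "T = (V - Y) \<times> {False} \<union> X \<times> {True}"
  have TV: "T \<subseteq> V \<times> UNIV" using XY by (auto simp: T_def)
  have finT: "finite T" using finite_subset[OF TV] V by simp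
  have cT: "card {x\<in>T. fst x \<in> C} + card (Y \<inter> C) = card C + card (X \<inter> C)" if "C \<subseteq> V" for C
  proof -
    have finC: "finite C" using that V finite_subset by blast
    have "{x\<in>T. fst x \<in> C} = (C - Y) \<times> {False} \<union> (X \<inter> C) \<times> {True}"
      using that by (auto simp: T_def)
    then have "card {x\<in>T. fst x \<in> C} = card ((C - Y) \<times> {False}) + card ((X \<inter> C) \<times> {True})"
      using finC by (simp only:) (rule card_Un_disjoint, auto)
    then have "card {x\<in>T. fst x \<in> C} = card (C - Y) + card (X \<inter> C)"
      by (simp add: card_cartesian_product)
    moreover have "card (C - Y) + card (Y \<inter> C) = card C"
      using finC by (metis card_Diff_subset_Int Int_commute card_mono finite_Int inf_le1 le_add_diff_inverse2)
    ultimately show ?thesis by simp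
  qed
  have PC: "card {x\<in>T. fst x \<in> C} = card C" if "C \<in> P" for C
  proof -
    have "C \<subseteq> V" using that UP by auto
    then show ?thesis using cT[of C] XY(3) that by simp
  qed
  have QD: "card {x\<in>T. fst x \<in> D} = shifted_cap s t D" if "D \<in> Q" for D
  proof -
    have "D \<subseteq> V" using that UP by auto
    moreover from this have "finite D" using V finite_subset by blast
    then have "card (D - {s}) + of_bool (s \<in> D) = card D"
      using card_Suc_Diff1[of D s] by (cases "s \<in> D") auto
    ultimately show ?thesis using cT[of D] XY(4) that
      by (cases "t \<in> D"; cases "s \<in> D") (auto simp: shifted_cap_def)
  qed
  have "card T = (\<Sum>C\<in>P. card {x\<in>T. fst x \<in> C})"
    using finT finite_elements[OF V P] P TV by (intro card_eq_sum_fibres) auto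
  also have "\<dots> = (\<Sum>C\<in>P. card C)" using PC by simp
  also have "\<dots> = card V"
    using P V UP by (intro product_partition[symmetric]) (auto intro: finite_subset)
  finally have "card T = card V" .
  then show ?thesis
    using PC QD TV UP by (intro exI[of _ T]) (auto simp: block_indep_def)
qed

lemma card_block_indep_le:
  assumes "finite V" "partition_on V P" "T \<in> block_indep P card"
  shows "card T \<le> card V"
proof -
  have TV: "T \<subseteq> V \<times> UNIV" using assms(3) partition_onD1[OF assms(2)] by (simp add: block_indep_def)
  have "finite T" using finite_subset[OF TV] assms(1) by simp
  then have "card T = (\<Sum>C\<in>P. card {x\<in>T. fst x \<in> C})"
    using finite_elements[OF assms(1,2)] assms(2) TV by (intro card_eq_sum_fibres) auto
  also have "\<dots> \<le> (\<Sum>C\<in>P. card C)"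
    using assms(3) by (intro sum_mono) (auto simp: block_indep_def)
  also have "\<dots> = card V"
    using assms(1,2) partition_onD1[OF assms(2)]
    by (intro product_partition[symmetric]) (auto intro: finite_subset)
  finally show ?thesis .
qed

subsection \<open>The lower bound\<close>

text \<open>\<open>Max\<close> bounds its elements only on finite sets; here every input lies in
  \<open>Pow (Pow U)\<close>.\<close>

lemma bits_le_communication_cost:
  assumes "finite U" "matroid U I1" "matroid U I2"
  shows "bits P I1 I2 \<le> communication_cost U P"
proof -
  have "{bits P I1 I2 | I1 I2. matroid U I1 \<and> matroid U I2}
      \<subseteq> (\<lambda>(I1, I2). bits P I1 I2) ` (Pow (Pow U) \<times> Pow (Pow U))"
    using matroid.indep_subset by fastforce
  then have "finite {bits P I1 I2 | I1 I2. matroid U I1 \<and> matroid U I2}"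
    by (rule finite_subset) (use assms(1) in simp)
  then show ?thesis unfolding communication_cost_def using assms by (intro Max_ge) blast+
qed

text \<open>The size of the protocol's output reveals whether the join connects \<open>s\<close> and
  \<open>t\<close>. The protocol thus computes the disconnection matrix, whose rows for separating
  partitions are independent, and the rank bound applies.\<close>

lemma card_separating_partitions_le:
  fixes V :: "'v set" and U :: "'a set"
  assumes U: "finite U" and V: "finite V" "2 * card V \<le> card U" "s \<in> V" "t \<in> V" "s \<noteq> t"
    and sol: "solves_matroid_intersection U prot"
  shows "card {P. partition_on V P \<and> separates s t P} \<le> 2 ^ communication_cost U prot"
proof -
  have "card (V \<times> (UNIV :: bool set)) \<le> card U" using V by (simp add: card_cartesian_product)
  then obtain f where f: "f ` (V \<times> (UNIV :: bool set)) \<subseteq> U" "inj_on f (V \<times> (UNIV :: bool set))"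
    using card_le_inj[of "V \<times> (UNIV :: bool set)" U] U V(1) by auto
  define a where "a P = (`) f ` block_indep P card" for P
  define b where "b Q = (`) f ` block_indep Q (shifted_cap s t)" for Q
  have ma: "matroid U (a P)" if "partition_on V P" for P
    unfolding a_def using matroid_image[OF matroid_block_indep[OF V(1) that] f(2,1) U] .
  have mb: "matroid U (b P)" if "partition_on V P" for P
    unfolding b_def using matroid_image[OF matroid_block_indep[OF V(1) that] f(2,1) U] .
  define \<phi> :: "'a set \<Rightarrow> real" where "\<phi> S = (if card S = card V then 0 else 1)" for S
  have \<phi>: "\<phi> (outcome prot (a P) (b Q)) = (if (s, t) \<in> join_rel P Q then 0 else 1)"
    if P: "partition_on V P" and Q: "partition_on V Q" for P Q
  proof -
    let ?S = "outcome prot (a P) (b Q)"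
    have max: "is_arg_max card (\<lambda>S. S \<in> a P \<inter> b Q) ?S"
      using sol ma[OF P] mb[OF Q] unfolding solves_matroid_intersection_def by blast
    then have "?S \<in> a P" "?S \<in> b Q" by (auto simp: is_arg_max_def)
    then obtain T T' where T: "T \<in> block_indep P card" "?S = f ` T"
      and T': "T' \<in> block_indep Q (shifted_cap s t)" "?S = f ` T'"
      unfolding a_def b_def by (elim imageE) blast
    have sub: "X \<subseteq> V \<times> UNIV" if "X \<in> block_indep P card \<or> X \<in> block_indep Q (shifted_cap s t)" for X
      using that partition_onD1[OF P] partition_onD1[OF Q] by (auto simp: block_indep_def)
    have card_f: "card (f ` X) = card X" if "X \<in> block_indep P card" for X
      using sub[of X] that f(2) by (meson card_image inj_on_subset)
    \<comment> \<open>Injectivity of \<open>f\<close> makes the two preimages of the output equal,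
      so one set is independent for both players.\<close>
    have "T = T'" using T T' sub[of T] sub[of T'] f(2) by (metis inj_on_image_eq_iff)
    have "card ?S = card V \<longleftrightarrow> (s, t) \<in> join_rel P Q"
    proof
      assume "card ?S = card V"
      then show "(s, t) \<in> join_rel P Q"
        using common_indep_imp_connected[OF V(1,3) P Q T(1)] T' T card_f[OF T(1)] \<open>T = T'\<close> by simp
    next
      assume "(s, t) \<in> join_rel P Q"
      then obtain X where X: "X \<in> block_indep P card" "X \<in> block_indep Q (shifted_cap s t)" "card X = card V"
        using connected_imp_common_indep[OF V(1) P Q] by blast
      then have "f ` X \<in> a P \<inter> b Q" by (auto simp: a_def b_def)
      then have "card (f ` X) \<le> card ?S"
        using max unfolding is_arg_max_def by (meson linorder_not_less)
      then show "card ?S = card V"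
        using card_block_indep_le[OF V(1) P T(1)] X card_f T by simp
    qed
    then show ?thesis by (simp add: \<phi>_def)
  qed
  let ?I = "{P. partition_on V P \<and> separates s t P}"
  have indep: "c P = 0"
    if rel: "\<And>Q. Q \<in> ?I \<Longrightarrow> (\<Sum>P\<in>?I. c P * \<phi> (outcome prot (a P) (b Q))) = 0" and P: "P \<in> ?I" for c P
  proof -
    have "(\<Sum>P\<in>?I. c P * (if (s, t) \<in> join_rel P Q then 0 else 1)) = 0" if "Q \<in> ?I" for Q
      using rel[OF that] that by (simp add: \<phi>)
    then show ?thesis using disconnection_rows_independent[OF V(1,3-5), of c P] P by simp
  qed
  have "bits prot (a P) (b Q) \<le> communication_cost U prot" if "P \<in> ?I" "Q \<in> ?I" for P Q
    using that bits_le_communication_cost[OF U ma mb] by simp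
  moreover have "finite ?I" using finitely_many_partition_on[OF V(1)] by simp
  ultimately show ?thesis
    using independent_rows_card_le[of ?I ?I prot a b _ \<phi>] indep by blast
qed

section \<open>Counting separating partitions\<close>

text \<open>Each of the \<open>k ^ k\<close> functions from \<open>A\<close> to \<open>B\<close>
  gives the partition into its fibres, each joined with its value, besides \<open>{0}\<close> and
  \<open>{1}\<close>. Including the value keeps blocks of empty fibres nonempty and makes the
  function recoverable.\<close>

lemma power_self_le_card_separating_partitions:
  "k ^ k \<le> card {P. partition_on {..<2 * k + 2} P \<and> separates 0 1 (P :: nat set set)}"
proof -
  define A B where "A = {2..<k + 2}" and "B = {k + 2..<2 * k + 2}"
  define F where "F h = {{0}, {1}} \<union> (\<lambda>b. insert b {a\<in>A. h a = b}) ` B" for h :: "nat \<Rightarrow> nat"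
  have AB: "{..<2 * k + 2} = {0, 1} \<union> A \<union> B" by (auto simp: A_def B_def)
  have disj: "0 \<notin> A" "1 \<notin> A" "0 \<notin> B" "1 \<notin> B" "A \<inter> B = {}" by (auto simp: A_def B_def)
  have "F h \<in> {P. partition_on {..<2 * k + 2} P \<and> separates 0 1 P}" if h: "h \<in> A \<rightarrow>\<^sub>E B" for h
  proof -
    have "partition_on {..<2 * k + 2} (F h)"
    proof (rule partition_onI)
      show "\<Union>(F h) = {..<2 * k + 2}" unfolding AB using h by (auto simp: F_def)
      show "{} \<notin> F h" by (auto simp: F_def)
      fix p q assume "p \<in> F h" "q \<in> F h" "p \<noteq> q"
      then show "disjnt p q" using disj by (auto simp: F_def disjnt_iff)
    qed
    moreover have "separates 0 1 (F h)" using disj by (auto simp: F_def separates_def)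
    ultimately show ?thesis by simp
  qed
  moreover have "inj_on F (A \<rightarrow>\<^sub>E B)"
  proof (rule inj_onI)
    fix g h assume g: "g \<in> A \<rightarrow>\<^sub>E B" and h: "h \<in> A \<rightarrow>\<^sub>E B" and eq: "F g = F h"
    show "g = h"
    proof (rule PiE_ext[OF g h])
      fix a assume a: "a \<in> A"
      then have gB: "g a \<in> B" using g by auto
      then have "insert (g a) {x\<in>A. g x = g a} \<in> F h" unfolding eq[symmetric] by (auto simp: F_def)
      moreover have "a \<in> insert (g a) {x\<in>A. g x = g a}" using a by auto
      ultimately obtain b where b: "b \<in> B" "insert (g a) {x\<in>A. g x = g a} = insert b {x\<in>A. h x = b}"
        using a disj unfolding F_def by blast
      \<comment> \<open>Each such block meets \<open>B\<close> in exactly one point.\<close>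
      have "g a = b" using b gB disj by blast
      moreover have "a \<in> insert b {x\<in>A. h x = b}" using a b(2) by auto
      then have "h a = b" using a b(1) disj by auto
      ultimately show "g a = h a" by simp
    qed
  qed
  ultimately have "card (A \<rightarrow>\<^sub>E B) \<le> card {P. partition_on {..<2 * k + 2} P \<and> separates 0 1 (P :: nat set set)}"
    by (intro card_inj_on_le[of F]) (auto simp: finitely_many_partition_on)
  then show ?thesis by (simp add: card_PiE A_def B_def)
qed

theorem theorem8p1:
  "\<exists>c::real. c > 0 \<and> (\<exists>N::nat. \<forall>n\<ge>N. \<forall>U::'a set. finite U \<and> card U = n \<longrightarrow>
     (\<forall>P. solves_matroid_intersection U P \<longrightarrow>
        c * (real n * log 2 (real n)) \<le> real (communication_cost U P)))"
proof (intro exI[of _ "1/16"] conjI exI[of _ 64] allI impI)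
  show "(0::real) < 1/16" by simp
  fix n :: nat and U :: "'a set" and prot :: "'a matroid_protocol"
  assume n: "64 \<le> n" and U: "finite U \<and> card U = n" and sol: "solves_matroid_intersection U prot"
  \<comment> \<open>Chosen so that two copies of the \<open>2 * k + 2\<close> points fit into
    \<open>U\<close>.\<close>
  define k where "k = (n - 4) div 4"
  define d where "d = communication_cost U prot"
  have k: "real n / 8 \<le> real k" using n unfolding k_def by linarith
  have "4 * k + 4 \<le> n" using n unfolding k_def by linarith
  then have "card {P. partition_on {..<2 * k + 2} P \<and> separates 0 1 (P :: nat set set)} \<le> 2 ^ d"
    unfolding d_def using U by (intro card_separating_partitions_le sol) auto
  then have "k ^ k \<le> 2 ^ d"
    using power_self_le_card_separating_partitions[of k] by linarith
  then have "real k ^ k \<le> 2 ^ d" by (metis numeral_power_le_of_nat_cancel_iff of_nat_le_iff of_nat_numeral of_nat_power)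
  moreover have k0: "0 < real k" using k n by linarith
  ultimately have "log 2 (real k ^ k) \<le> log 2 (2 ^ d)" by (subst log_le_cancel_iff) auto
  then have kd: "real k * log 2 (real k) \<le> real d" using k0 by (simp add: log_nat_power)
  \<comment> \<open>The threshold 64 gives \<open>log 2 n - 3 \<ge> log 2 n / 2\<close>. With
    \<open>k \<ge> n / 8\<close> this yields the constant \<open>1/8 * 1/2 = 1/16\<close>.\<close>
  have "log 2 64 \<le> log 2 (real n)" using n by (subst log_le_cancel_iff) auto
  moreover have "log 2 64 = (6::real)" using log_pow_cancel[of 2 6] by simp
  ultimately have n6: "6 \<le> log 2 (real n)" by simp
  have "log 2 (real n / 8) \<le> log 2 (real k)" using k n k0 by (subst log_le_cancel_iff) auto
  moreover have "log 2 (real n / 8) = log 2 (real n) - 3"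
    using n log_pow_cancel[of 2 3] by (simp add: log_divide)
  ultimately have "log 2 (real n) / 2 \<le> log 2 (real k)" using n6 by linarith
  then have "real n / 8 * (log 2 (real n) / 2) \<le> real k * log 2 (real k)"
    using k n6 by (intro mult_mono) auto
  then show "1 / 16 * (real n * log 2 (real n)) \<le> real (communication_cost U prot)"
    using kd by (simp add: d_def)
qed

end
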